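(* In the abstract setting described in the context, assume that B1–B5 hold and that the parameter $\beta$ is large enough. Then there exists a unique $u_h\in V_h^E$ such that $$a_h(u_h,v)=l_h(v)\qquad\forall v\in V_h^E,$$ and the following best approximation estimate holds: $$|||u-u_h|||_h\lesssim |||u-v|||_h\qquad\forall v\in V_h^E .$$
   Context: Abstract setting. $\Omega\subset\mathbb R^d$ is a domain, $V$ is a Hilbert space of functions on $\Omega$, $V_{bc}\subset V$ is the subset of functions satisfying given boundary conditions, and $V_{bc,0}$ the corresponding space with homogeneous boundary conditions. $u\in V_{bc}$ is the solution of $a_\Omega(u,v)=l(v)$ for all $v\in V_{bc,0}$, where $a_\Omega$ is a continuous and coercive bilinear form and $l$ a continuous linear functional. $\widetilde V\subset V$ is a subspace of functions with additional regularity on which the boundary forms below are defined, and it is assumed that $u\in\widetilde V$. $V_h^E$, $h\in(0,h_0]$, is a family of finite dimensional spaces (extended finite element spaces). With bilinear forms $a_{\partial\Omega}$ and $b$ and a parameter $\beta>0$, set $$a_h(v,w)=a_\Omega(v,w)-a_{\partial\Omega}(v,w)-a_{\partial\Omega}(w,v)+\beta b(v,w),\qquad l_h(v)=l(v)-a_{\partial\Omega}(v,u)+\beta b(v,u).$$ $a\lesssim b$ means $a\le Cb$ with $C$ independent of the functions involved, of the mesh parameter $h$ and of the intersection of the domain and the mesh. Assumptions. B1: There is a norm $|||\cdot|||_\Omega$ on $\widetilde V+V_h^E$ such that $a_\Omega(v,w)\lesssim|||v|||_\Omega|||w|||_\Omega$ for $v,w\in\widetilde V+V_h^E$ and $|||v|||_\Omega^2\lesssim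 a_\Omega(v,v)$ for $v\in V_h^E$. B2: $b$ induces a seminorm $\|\cdot\|_b$ on $\widetilde V+V_h^E$ (i.e. $b$ is symmetric positive semidefinite and $\|v\|_b^2=b(v,v)$), and there is a seminorm $|||\cdot|||_{\partial\Omega}$ on $\widetilde V+V_h^E$ with $|a_{\partial\Omega}(v,w)|\lesssim|||v|||_{\partial\Omega}\|w\|_b$ for $v,w\in\widetilde V+V_h^E$. B3: $|||v|||_{\partial\Omega}\lesssim|||v|||_\Omega$ for $v\in V_h^E$ (consequently $|a_{\partial\Omega}(v,w)|\lesssim|||v|||_\Omega\|w\|_b$ for $v,w\in V_h^E$). B4: $|l_h(v)|\lesssim|||v|||_h$ for $v\in V_h^E$, where the energy norm is $|||v|||_h^2=|||v|||_\Omega^2+|||v|||_{\partial\Omega}^2+\|v\|_b^2$. B5: (Consistency) the solution $u\in\widetilde V$ satisfies $a_h(u,v)=l_h(v)$ for all $v\in\widetilde V+V_h^E$. *)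

theory Defs
  imports "HOL-Analysis.Analysis"
begin

(* Function spaces are subsets of an ambient real vector space 'f; all maps and forms are
   total functions on 'f that are constrained only on the relevant subset. *)

definition linear_on :: "'f::real_vector set \<Rightarrow> ('f \<Rightarrow> 'g::real_vector) \<Rightarrow> bool" where
  "linear_on W f \<longleftrightarrow>
     (\<forall>x\<in>W. \<forall>y\<in>W. f (x + y) = f x + f y) \<and> (\<forall>c. \<forall>x\<in>W. f (c *\<^sub>R x) = c *\<^sub>R f x)"

definition bilinear_form_on :: "'f::real_vector set \<Rightarrow> ('f \<Rightarrow> 'f \<Rightarrow> real) \<Rightarrow> bool" where
  "bilinear_form_on W B \<longleftrightarrow>
     (\<forall>y\<in>W. linear_on W (\<lambda>x. B x y)) \<and> (\<forall>x\<in>W. linear_on W (\<lambda>y. B x y))"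

definition seminorm_on :: "'f::real_vector set \<Rightarrow> ('f \<Rightarrow> real) \<Rightarrow> bool" where
  "seminorm_on W p \<longleftrightarrow>
     (\<forall>x\<in>W. 0 \<le> p x) \<and>
     (\<forall>x\<in>W. \<forall>y\<in>W. p (x + y) \<le> p x + p y) \<and>
     (\<forall>c. \<forall>x\<in>W. p (c *\<^sub>R x) = \<bar>c\<bar> * p x)"

definition norm_on :: "'f::real_vector set \<Rightarrow> ('f \<Rightarrow> real) \<Rightarrow> bool" where
  "norm_on W p \<longleftrightarrow> seminorm_on W p \<and> (\<forall>x\<in>W. p x = 0 \<longrightarrow> x = 0)"

definition form_norm :: "('f \<Rightarrow> 'f \<Rightarrow> real) \<Rightarrow> 'f \<Rightarrow> real" where
  "form_norm B v = sqrt (B v v)"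

definition hilbert_space_on :: "'f::real_vector set \<Rightarrow> ('f \<Rightarrow> 'f \<Rightarrow> real) \<Rightarrow> bool" where
  "hilbert_space_on V ip \<longleftrightarrow>
     subspace V \<and> bilinear_form_on V ip \<and>
     (\<forall>x\<in>V. \<forall>y\<in>V. ip x y = ip y x) \<and>
     (\<forall>x\<in>V. x \<noteq> 0 \<longrightarrow> 0 < ip x x) \<and>
     (\<forall>X::nat \<Rightarrow> 'f. range X \<subseteq> V \<longrightarrow>
        (\<forall>e>0. \<exists>N. \<forall>m\<ge>N. \<forall>n\<ge>N. form_norm ip (X m - X n) < e) \<longrightarrow>
        (\<exists>x\<in>V. (\<lambda>n. form_norm ip (X n - x)) \<longlonglongrightarrow> 0))"

(* The vectors in W are functions on the domain D, identified when they agree almost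
   everywhere: rep f is a representative of f. It is constrained only almost everywhere on D,
   so that Lebesgue and Sobolev spaces are covered. *)
definition functions_on ::
  "'d::euclidean_space set \<Rightarrow> ('f::real_vector \<Rightarrow> 'd \<Rightarrow> 'c::real_vector) \<Rightarrow> 'f set \<Rightarrow> bool" where
  "functions_on D rep W \<longleftrightarrow>
     (\<forall>f\<in>W. \<forall>g\<in>W. AE x in lebesgue_on D. rep (f + g) x = rep f x + rep g x) \<and>
     (\<forall>c. \<forall>f\<in>W. AE x in lebesgue_on D. rep (c *\<^sub>R f) x = c *\<^sub>R rep f x) \<and>
     (\<forall>f\<in>W. \<forall>g\<in>W. (AE x in lebesgue_on D. rep f x = rep g x) \<longrightarrow> f = g)"

(* Elements of V satisfying the boundary conditions with data g; tr is the (linear) boundary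
   operator, e.g. a tuple of traces. The homogeneous space is the case g = 0. *)
definition boundary_space :: "'f set \<Rightarrow> ('f \<Rightarrow> 'g) \<Rightarrow> 'g \<Rightarrow> 'f set" where
  "boundary_space V tr g = {v \<in> V. tr v = g}"

definition continuous_form_on :: "'f set \<Rightarrow> ('f \<Rightarrow> real) \<Rightarrow> ('f \<Rightarrow> 'f \<Rightarrow> real) \<Rightarrow> bool" where
  "continuous_form_on V nrm B \<longleftrightarrow> (\<exists>C>0. \<forall>v\<in>V. \<forall>w\<in>V. \<bar>B v w\<bar> \<le> C * nrm v * nrm w)"

definition coercive_form_on :: "'f set \<Rightarrow> ('f \<Rightarrow> real) \<Rightarrow> ('f \<Rightarrow> 'f \<Rightarrow> real) \<Rightarrow> bool" where
  "coercive_form_on V nrm B \<longleftrightarrow> (\<exists>c>0. \<forall>v\<in>V. c * (nrm v)\<^sup>2 \<le> B v v)"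

definition continuous_functional_on :: "'f set \<Rightarrow> ('f \<Rightarrow> real) \<Rightarrow> ('f \<Rightarrow> real) \<Rightarrow> bool" where
  "continuous_functional_on V nrm l \<longleftrightarrow> (\<exists>C>0. \<forall>v\<in>V. \<bar>l v\<bar> \<le> C * nrm v)"

definition finite_dim_space :: "'f::real_vector set \<Rightarrow> bool" where
  "finite_dim_space W \<longleftrightarrow> (\<exists>B. finite B \<and> W = span B)"

definition discrete_form ::
  "('f \<Rightarrow> 'f \<Rightarrow> real) \<Rightarrow> ('f \<Rightarrow> 'f \<Rightarrow> real) \<Rightarrow> ('f \<Rightarrow> 'f \<Rightarrow> real) \<Rightarrow> real \<Rightarrow> 'f \<Rightarrow> 'f \<Rightarrow> real" where
  "discrete_form a ab b \<beta> v w = a v w - ab v w - ab w v + \<beta> * b v w"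

definition discrete_rhs ::
  "('f \<Rightarrow> real) \<Rightarrow> ('f \<Rightarrow> 'f \<Rightarrow> real) \<Rightarrow> ('f \<Rightarrow> 'f \<Rightarrow> real) \<Rightarrow> real \<Rightarrow> 'f \<Rightarrow> 'f \<Rightarrow> real" where
  "discrete_rhs l ab b \<beta> u v = l v - ab v u + \<beta> * b v u"

definition energy_norm ::
  "('f \<Rightarrow> real) \<Rightarrow> ('f \<Rightarrow> real) \<Rightarrow> ('f \<Rightarrow> 'f \<Rightarrow> real) \<Rightarrow> 'f \<Rightarrow> real" where
  "energy_norm nO nb b v = sqrt ((nO v)\<^sup>2 + (nb v)\<^sup>2 + (form_norm b v)\<^sup>2)"

end

theory Submission
  imports Defs
begin

text \<open>
  For large \<open>\<beta>\<close>, Young's inequality absorbs the two boundary terms of the discrete form into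
  \<open>a\<close> and \<open>\<beta> b\<close>, so the discrete form is coercive for the energy norm on the discrete space;
  it is bounded on the whole sum space. By consistency the discrete right-hand side is the functional
  \<open>v \<mapsto> a\<^sub>h(u, v)\<close>, so the discrete solution is a (nonsymmetric) Galerkin projection of \<open>u\<close>,
  and Cea's argument gives the best approximation estimate.
\<close>

section \<open>Bilinear forms and seminorms on a subspace\<close>

lemma bilinear_form_onD:
  assumes "bilinear_form_on W F" "x \<in> W" "y \<in> W" "z \<in> W"
  shows "F (x + y) z = F x z + F y z" "F z (x + y) = F z x + F z y"
    "F (c *\<^sub>R x) z = c * F x z" "F z (c *\<^sub>R x) = c * F z x"
  using assms unfolding bilinear_form_on_def linear_on_def by auto

lemma bilinear_form_on_diff:
  assumes "bilinear_form_on W F" "subspace W" "x \<in> W" "y \<in> W" "z \<in> W"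
  shows "F (x - y) z = F x z - F y z" "F z (x - y) = F z x - F z y"
proof -
  have m: "(-1) *\<^sub>R y \<in> W" using assms by (meson subspace_scale)
  have e: "x - y = x + (-1) *\<^sub>R y" by simp
  show "F (x - y) z = F x z - F y z" "F z (x - y) = F z x - F z y"
    unfolding e bilinear_form_onD(1,2)[OF assms(1,3) m assms(5)]
      bilinear_form_onD(3,4)[OF assms(1,4,4,5)] by simp_all
qed

lemma bilinear_form_on_zero:
  assumes "bilinear_form_on W F" "x \<in> W" "y \<in> W"
  shows "F 0 y = 0"
  using bilinear_form_onD(3)[OF assms(1,2,2,3), of 0] by simp

text \<open>The quadratic polynomial \<open>F (t *\<^sub>R x + y) (t *\<^sub>R x + y)\<close> in
  \<open>t\<close> never becomes negative. Since \<open>F\<close> is only semidefinite, its leading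
  coefficient \<open>F x x\<close> may vanish, and that case is argued separately.\<close>

lemma form_Cauchy_Schwarz:
  assumes F: "bilinear_form_on W F" and W: "subspace W"
    and sym: "\<And>x y. x \<in> W \<Longrightarrow> y \<in> W \<Longrightarrow> F x y = F y x"
    and pos: "\<And>x. x \<in> W \<Longrightarrow> 0 \<le> F x x"
    and x: "x \<in> W" and y: "y \<in> W"
  shows "\<bar>F x y\<bar> \<le> form_norm F x * form_norm F y"
proof -
  have q: "0 \<le> F x x * t\<^sup>2 + 2 * F x y * t + F y y" for t
  proof -
    have tx: "t *\<^sub>R x \<in> W" using W x by (rule subspace_scale)
    have "0 \<le> F (t *\<^sub>R x + y) (t *\<^sub>R x + y)"
      using W tx y by (intro pos subspace_add)
    also have "\<dots> = F x x * t\<^sup>2 + 2 * F x y * t + F y y"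
      using bilinear_form_onD[OF F tx y tx] bilinear_form_onD[OF F tx y y]
        bilinear_form_onD(1)[OF F tx y, of "t *\<^sub>R x + y"]
        bilinear_form_onD(3,4)[OF F x x x] bilinear_form_onD(3,4)[OF F x x tx]
        bilinear_form_onD(3,4)[OF F x x y] sym[OF y x] subspace_add[OF W tx y]
      by (simp add: power2_eq_square algebra_simps)
    finally show ?thesis .
  qed
  have "(F x y)\<^sup>2 \<le> F x x * F y y"
  proof (cases "F x x = 0")
    case True
    have "F x y = 0"
    proof (rule ccontr)
      assume "F x y \<noteq> 0"
      \<comment> \<open>With \<open>F x x = 0\<close> the polynomial is affine; at this
        \<open>t\<close> it takes the value -1.\<close>
      with q[of "- (F y y + 1) / (2 * F x y)"] True show False by (simp add: field_simps)
    qed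
    with True show ?thesis by simp
  next
    case False
    with pos[OF x] have p: "0 < F x x" by simp
    \<comment> \<open>This is the minimiser of the quadratic; its minimum is \<open>F y y\<close>
      minus \<open>(F x y)\<^sup>2 / F x x\<close>.\<close>
    from q[of "- F x y / F x x"] p show ?thesis
      by (simp add: field_simps power2_eq_square)
  qed
  then have "sqrt ((F x y)\<^sup>2) \<le> sqrt (F x x * F y y)" by (rule real_sqrt_le_mono)
  then show ?thesis by (simp add: form_norm_def real_sqrt_mult)
qed

text \<open>Cauchy-Schwarz bounds the cross term in the expansion of
  \<open>F (x + y) (x + y)\<close>, which gives the triangle inequality. It is needed to treat the
  part of the energy norm induced by \<open>b\<close> like the other two.\<close>

lemma seminorm_on_form_norm:
  assumes F: "bilinear_form_on W F" and W: "subspace W"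
    and sym: "\<And>x y. x \<in> W \<Longrightarrow> y \<in> W \<Longrightarrow> F x y = F y x"
    and pos: "\<And>x. x \<in> W \<Longrightarrow> 0 \<le> F x x"
  shows "seminorm_on W (form_norm F)"
  unfolding seminorm_on_def
proof (intro conjI ballI allI)
  fix x assume x: "x \<in> W"
  show "0 \<le> form_norm F x" using pos[OF x] by (simp add: form_norm_def)
next
  fix x y assume x: "x \<in> W" and y: "y \<in> W"
  have xy: "x + y \<in> W" using W x y by (rule subspace_add)
  have "F (x + y) (x + y) = F x x + 2 * F x y + F y y"
    using bilinear_form_onD(1)[OF F x y xy] bilinear_form_onD(2)[OF F x y x]
      bilinear_form_onD(2)[OF F x y y] sym[OF x y] by simp
  also have "\<dots> \<le> (form_norm F x + form_norm F y)\<^sup>2"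
    using form_Cauchy_Schwarz[OF F W sym pos x y] pos[OF x] pos[OF y]
    by (simp add: power2_sum form_norm_def)
  finally have "sqrt (F (x + y) (x + y)) \<le> form_norm F x + form_norm F y"
    using pos[OF x] pos[OF y] by (intro real_le_lsqrt) (simp_all add: form_norm_def)
  then show "form_norm F (x + y) \<le> form_norm F x + form_norm F y" by (simp add: form_norm_def)
next
  fix c x assume x: "x \<in> W"
  have cx: "c *\<^sub>R x \<in> W" using W x by (rule subspace_scale)
  have "F (c *\<^sub>R x) (c *\<^sub>R x) = c\<^sup>2 * F x x"
    using bilinear_form_onD(3)[OF F x x cx] bilinear_form_onD(4)[OF F x x x]
    by (simp add: power2_eq_square)
  then show "form_norm F (c *\<^sub>R x) = \<bar>c\<bar> * form_norm F x"
    by (simp add: form_norm_def real_sqrt_mult)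
qed

text \<open>The value is the Euclidean length of the pair (\<open>p x\<close>, \<open>q x\<close>).
  Squaring is monotone on nonnegative entries, so the pair at \<open>x + y\<close> is no longer than
  the sum of the two pairs, and the triangle inequality of the plane finishes the argument.\<close>

lemma seminorm_on_sqrt_sum_squares:
  assumes W: "subspace W" and p: "seminorm_on W p" and q: "seminorm_on W q"
  shows "seminorm_on W (\<lambda>x. sqrt ((p x)\<^sup>2 + (q x)\<^sup>2))"
  unfolding seminorm_on_def
proof (intro conjI ballI allI)
  fix x y assume xy: "x \<in> W" "y \<in> W"
  then have "x + y \<in> W" using W by (simp add: subspace_add)
  with xy have "0 \<le> p (x + y)" "0 \<le> q (x + y)"
    "p (x + y) \<le> p x + p y" "q (x + y) \<le> q x + q y"
    using p q unfolding seminorm_on_def by auto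
  then have "sqrt ((p (x + y))\<^sup>2 + (q (x + y))\<^sup>2) \<le> sqrt ((p x + p y)\<^sup>2 + (q x + q y)\<^sup>2)"
    by (intro real_sqrt_le_mono add_mono power_mono)
  also have "\<dots> \<le> sqrt ((p x)\<^sup>2 + (q x)\<^sup>2) + sqrt ((p y)\<^sup>2 + (q y)\<^sup>2)"
    by (rule real_sqrt_sum_squares_triangle_ineq)
  finally show "sqrt ((p (x + y))\<^sup>2 + (q (x + y))\<^sup>2)
      \<le> sqrt ((p x)\<^sup>2 + (q x)\<^sup>2) + sqrt ((p y)\<^sup>2 + (q y)\<^sup>2)" .
next
  fix c x assume "x \<in> W"
  then have "p (c *\<^sub>R x) = \<bar>c\<bar> * p x" "q (c *\<^sub>R x) = \<bar>c\<bar> * q x"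
    using p q unfolding seminorm_on_def by auto
  then have "(p (c *\<^sub>R x))\<^sup>2 + (q (c *\<^sub>R x))\<^sup>2 = c\<^sup>2 * ((p x)\<^sup>2 + (q x)\<^sup>2)"
    by (simp add: power_mult_distrib algebra_simps)
  then show "sqrt ((p (c *\<^sub>R x))\<^sup>2 + (q (c *\<^sub>R x))\<^sup>2) = \<bar>c\<bar> * sqrt ((p x)\<^sup>2 + (q x)\<^sup>2)"
    by (simp add: real_sqrt_mult)
qed simp

lemma seminorm_on_energy_norm:
  assumes "subspace W" "seminorm_on W nO" "seminorm_on W nb" "seminorm_on W (form_norm b)"
  shows "seminorm_on W (energy_norm nO nb b)"
proof -
  \<comment> \<open>Nesting the combination of two seminorms covers all three.\<close>
  have "energy_norm nO nb b =
      (\<lambda>v. sqrt ((sqrt ((nO v)\<^sup>2 + (nb v)\<^sup>2))\<^sup>2 + (form_norm b v)\<^sup>2))"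
    by (simp add: energy_norm_def fun_eq_iff)
  with assms show ?thesis by (simp only: seminorm_on_sqrt_sum_squares)
qed

lemma energy_norm_ge:
  "nO v \<le> energy_norm nO nb b v" "nb v \<le> energy_norm nO nb b v"
  "form_norm b v \<le> energy_norm nO nb b v"
  by (auto simp: energy_norm_def intro!: real_le_rsqrt)

lemma bilinear_form_on_subset:
  "bilinear_form_on W F \<Longrightarrow> X \<subseteq> W \<Longrightarrow> bilinear_form_on X F"
  unfolding bilinear_form_on_def linear_on_def by (meson subsetD)

lemma bilinear_form_on_discrete_form:
  assumes "bilinear_form_on W a" "bilinear_form_on W ab" "bilinear_form_on W b"
  shows "bilinear_form_on W (discrete_form a ab b \<beta>)"
  using assms unfolding bilinear_form_on_def linear_on_def discrete_form_def
  by (simp add: algebra_simps)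

section \<open>Galerkin projections and Cea's argument\<close>

text \<open>Gram-Schmidt without symmetry: the new direction is made left orthogonal to the old span.\<close>

lemma Galerkin_projection_exists:
  assumes "finite B" "span B \<subseteq> W" "subspace W" "bilinear_form_on W F"
    and "\<And>v. v \<in> span B \<Longrightarrow> F v v = 0 \<Longrightarrow> v = 0"
    and "u \<in> W"
  shows "\<exists>p\<in>span B. \<forall>v\<in>span B. F p v = F u v"
  using assms
proof (induction B arbitrary: u rule: finite_induct)
  case empty
  have "F u 0 = 0" "F 0 0 = 0"
    using bilinear_form_onD(4)[OF empty(3,5,5,5), of 0]
      bilinear_form_on_zero[OF empty(3,5) subspace_0[OF empty(2)]] by auto
  then show ?case by simp
next
  case (insert e B)
  note W = \<open>subspace W\<close> and F = \<open>bilinear_form_on W F\<close>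
  have sub: "span B \<subseteq> span (insert e B)" by (rule span_mono) auto
  have sB: "span B \<subseteq> W" using sub insert.prems(1) by blast
  have def': "v = 0" if "v \<in> span B" "F v v = 0" for v
    using insert.prems(4) that sub by blast
  have e: "e \<in> span (insert e B)" by (simp add: span_base)
  then have eW: "e \<in> W" using insert.prems(1) by blast
  have IH: "\<exists>p\<in>span B. \<forall>v\<in>span B. F p v = F x v" if "x \<in> W" for x
    using insert.IH[OF sB W F _ that] def' by blast
  \<comment> \<open>The induction hypothesis is used for two targets: \<open>w\<close> projects the
    new generator \<open>e\<close>, and \<open>u0\<close> is the projection of \<open>u\<close> that
    has to be corrected.\<close>
  from IH[OF eW] obtain w where w: "w \<in> span B" "\<And>v. v \<in> span B \<Longrightarrow> F w v = F e v" by blast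
  from IH[OF insert.prems(5)] obtain u0 where
    u0: "u0 \<in> span B" "\<And>v. v \<in> span B \<Longrightarrow> F u0 v = F u v" by blast
  show ?case
  proof (cases "e \<in> span B")
    case True
    then have "span (insert e B) = span B" by (rule span_redundant)
    then show ?thesis using u0 by auto
  next
    case False
    \<comment> \<open>By the choice of \<open>w\<close>, \<open>F q v = 0\<close> for every
      \<open>v\<close> in the old span. Without symmetry nothing similar is known about
      \<open>F v q\<close>.\<close>
    define q where "q = e - w"
    have wW: "w \<in> W" and u0W: "u0 \<in> W" using w u0 sB by auto
    have qs: "q \<in> span (insert e B)" unfolding q_def using e w sub by (intro span_diff) auto
    then have qW: "q \<in> W" using insert.prems(1) by blast
    have q0: "F q v = 0" if "v \<in> span B" for v
      using bilinear_form_on_diff(1)[OF F W eW wW, of v] that sB w(2)[OF that]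
      by (auto simp: q_def)
    have "q \<noteq> 0" using False w by (auto simp: q_def)
    then have qq: "F q q \<noteq> 0" using insert.prems(4)[OF qs] by blast
    \<comment> \<open>Adding a multiple of \<open>q\<close> in the first argument leaves the
      equations against the old span intact, so \<open>t\<close> can be chosen to satisfy the one
      remaining equation, against \<open>q\<close>. The term \<open>F u0 q\<close> stays because
      orthogonality holds on the left only.\<close>
    define t where "t = (F u q - F u0 q) / F q q"
    have tq: "t *\<^sub>R q \<in> W" using W qW by (rule subspace_scale)
    have p: "F (u0 + t *\<^sub>R q) v = F u0 v + t * F q v" if "v \<in> W" for v
      using bilinear_form_onD(1)[OF F u0W tq that] bilinear_form_onD(3)[OF F qW qW that] by simp
    show ?thesis
    proof (intro bexI ballI)
      show "u0 + t *\<^sub>R q \<in> span (insert e B)"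
        using u0 sub qs by (intro span_add span_scale) auto
      \<comment> \<open>A test vector splits into \<open>z\<close> from the old span and a multiple
        of \<open>q\<close>; replacing \<open>e\<close> by \<open>q\<close> changes it only by a
        multiple of \<open>w\<close>, which lies in the old span.\<close>
      fix v assume "v \<in> span (insert e B)"
      then obtain k where "v - k *\<^sub>R e \<in> span B" unfolding span_insert by blast
      moreover have "k *\<^sub>R w \<in> span B" using w(1) by (rule span_scale)
      ultimately have z: "v - k *\<^sub>R q \<in> span B"
        using span_add[of "v - k *\<^sub>R e" B "k *\<^sub>R w"] by (simp add: q_def algebra_simps)
      define z where "z = v - k *\<^sub>R q"
      have zB: "z \<in> span B" and zW: "z \<in> W" using z sB by (auto simp: z_def)
      have v: "v = z + k *\<^sub>R q" by (simp add: z_def)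
      have kq: "k *\<^sub>R q \<in> W" using W qW by (rule subspace_scale)
      have vW: "v \<in> W" unfolding v using W zW kq by (rule subspace_add)
      have split: "F x v = F x z + k * F x q" if "x \<in> W" for x
        using bilinear_form_onD(2)[OF F zW kq that] bilinear_form_onD(4)[OF F qW qW that]
        by (simp add: v)
      have "F (u0 + t *\<^sub>R q) v = F u0 z + k * (F u0 q + t * F q q)"
        using p[OF vW] split[OF u0W] split[OF qW] q0[OF zB] by (simp add: algebra_simps)
      also have "\<dots> = F u z + k * F u q" using u0(2)[OF zB] qq by (simp add: t_def)
      finally show "F (u0 + t *\<^sub>R q) v = F u v" using split[OF insert.prems(5)] by simp
    qed
  qed
qed

text \<open>The difference of two candidates is itself an admissible test vector, so definiteness
  applies to it.\<close>

lemma Galerkin_projection_unique: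
  assumes S: "subspace S" and F: "bilinear_form_on S F"
    and "\<And>v. v \<in> S \<Longrightarrow> F v v = 0 \<Longrightarrow> v = 0"
    and "p \<in> S" "q \<in> S" "\<And>v. v \<in> S \<Longrightarrow> F p v = F q v"
  shows "p = q"
proof -
  have d: "p - q \<in> S" using assms by (simp add: subspace_diff)
  then have "F (p - q) (p - q) = 0"
    using bilinear_form_on_diff(1)[OF F S \<open>p \<in> S\<close> \<open>q \<in> S\<close> d] assms(6) by simp
  then show ?thesis using assms(3)[OF d] by simp
qed

text \<open>Coercivity holds only on \<open>S\<close>, so it is applied to \<open>p - v\<close>
  rather than to the error \<open>u - p\<close>. Boundedness on all of \<open>W\<close> then
  controls \<open>p - v\<close> by \<open>u - v\<close>, and the triangle inequality contributes the
  summand 1 of the constant.\<close>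

lemma Cea:
  assumes W: "subspace W" and S: "subspace S" "S \<subseteq> W" and F: "bilinear_form_on W F"
    and N: "seminorm_on W N"
    and bdd: "\<And>v w. v \<in> W \<Longrightarrow> w \<in> W \<Longrightarrow> \<bar>F v w\<bar> \<le> K * N v * N w"
    and coer: "\<And>v. v \<in> S \<Longrightarrow> c * (N v)\<^sup>2 \<le> F v v" and c: "0 < c" and K: "0 \<le> K"
    and u: "u \<in> W" and p: "p \<in> S" "\<And>v. v \<in> S \<Longrightarrow> F p v = F u v" and v: "v \<in> S"
  shows "N (u - p) \<le> (1 + K / c) * N (u - v)"
proof -
  have vp: "v - p \<in> S" "p - v \<in> S" using S p v by (simp_all add: subspace_diff)
  have uv: "u - v \<in> W" using W S u v by (meson subsetD subspace_diff)
  have pv: "p - v \<in> W" "v - p \<in> W" using vp S by auto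
  have vW: "v \<in> W" "p \<in> W" using v p S by auto
  have nonneg: "0 \<le> N (u - v)" "0 \<le> N (p - v)" using N uv pv unfolding seminorm_on_def by auto
  have "c * (N (p - v))\<^sup>2 \<le> F (p - v) (p - v)" using vp by (intro coer)
  \<comment> \<open>Galerkin orthogonality: \<open>p - v\<close> lies in \<open>S\<close>, so
    \<open>p\<close> may be exchanged for \<open>u\<close> in the first argument.\<close>
  also have "\<dots> = F (u - v) (p - v)"
    using bilinear_form_on_diff(1)[OF F W _ vW(1) pv(1)] u vW p(2)[OF vp(2)] by simp
  also have "\<dots> \<le> K * N (u - v) * N (p - v)" using bdd[OF uv pv(1)] by linarith
  finally have "(c * N (p - v)) * N (p - v) \<le> (K * N (u - v)) * N (p - v)"
    by (simp add: power2_eq_square mult_ac)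
  \<comment> \<open>The common factor is cancelled; where it vanishes the left side is 0 and the
    right side is nonnegative.\<close>
  then have "c * N (p - v) \<le> K * N (u - v)"
    using nonneg K by (cases "N (p - v) = 0") auto
  then have est: "N (p - v) \<le> K / c * N (u - v)" using c by (simp add: field_simps)
  have "N (v - p) = N ((-1) *\<^sub>R (p - v))" by simp
  also have "\<dots> = \<bar>-1\<bar> * N (p - v)" using N pv(1) unfolding seminorm_on_def by blast
  finally have "N (v - p) = N (p - v)" by simp
  moreover have "N ((u - v) + (v - p)) \<le> N (u - v) + N (v - p)"
    using N uv pv unfolding seminorm_on_def by blast
  ultimately show ?thesis using est by (simp add: algebra_simps)
qed

section \<open>Boundedness and coercivity of the discrete form\<close>

text \<open>Each of the three seminorms is dominated by the energy norm, so the four terms of the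
  form contribute \<open>C1\<close>, \<open>C2\<close>, \<open>C2\<close> and
  \<open>\<beta>\<close>; the last one uses Cauchy-Schwarz for \<open>b\<close>.\<close>

lemma discrete_form_bounded:
  assumes W: "subspace W" and a: "bilinear_form_on W a"
    and b: "bilinear_form_on W b" "\<And>x y. x \<in> W \<Longrightarrow> y \<in> W \<Longrightarrow> b x y = b y x"
      "\<And>x. x \<in> W \<Longrightarrow> 0 \<le> b x x"
    and nO: "seminorm_on W nO" and nb: "seminorm_on W nb"
    and a_le: "\<And>v w. v \<in> W \<Longrightarrow> w \<in> W \<Longrightarrow> a v w \<le> C1 * (nO v * nO w)"
    and ab_le: "\<And>v w. v \<in> W \<Longrightarrow> w \<in> W \<Longrightarrow> \<bar>ab v w\<bar> \<le> C2 * (nb v * form_norm b w)"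
    and C: "0 \<le> C1" "0 \<le> C2" "0 \<le> \<beta>" and v: "v \<in> W" and w: "w \<in> W"
  shows "\<bar>discrete_form a ab b \<beta> v w\<bar>
    \<le> (C1 + 2 * C2 + \<beta>) * energy_norm nO nb b v * energy_norm nO nb b w"
proof -
  let ?E = "energy_norm nO nb b"
  have pos: "0 \<le> nO v" "0 \<le> nO w" "0 \<le> nb v" "0 \<le> nb w"
    "0 \<le> form_norm b v" "0 \<le> form_norm b w" "0 \<le> ?E v" "0 \<le> ?E w"
    using nO nb v w b(3) unfolding seminorm_on_def by (auto simp: form_norm_def energy_norm_def)
  \<comment> \<open>The bound on \<open>a\<close> is one-sided. Applied to the negative of
    \<open>v\<close> it also bounds \<open>a v w\<close> from below.\<close>
  have mv: "(-1) *\<^sub>R v \<in> W" using W v by (rule subspace_scale)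
  have "nO ((-1) *\<^sub>R v) = \<bar>-1\<bar> * nO v" using nO v unfolding seminorm_on_def by blast
  then have "- a v w \<le> C1 * (nO v * nO w)"
    using a_le[OF mv w] bilinear_form_onD(3)[OF a v v w, of "-1"] by simp
  with a_le[OF v w] have "\<bar>a v w\<bar> \<le> C1 * (nO v * nO w)" by simp
  also have "\<dots> \<le> C1 * (?E v * ?E w)"
    using pos C by (intro mult_left_mono mult_mono energy_norm_ge)
  finally have 1: "\<bar>a v w\<bar> \<le> C1 * (?E v * ?E w)" .
  have "\<bar>ab v w\<bar> \<le> C2 * (nb v * form_norm b w)" using v w by (rule ab_le)
  also have "\<dots> \<le> C2 * (?E v * ?E w)"
    using pos C by (intro mult_left_mono mult_mono energy_norm_ge)
  finally have 2: "\<bar>ab v w\<bar> \<le> C2 * (?E v * ?E w)" .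
  have "\<bar>ab w v\<bar> \<le> C2 * (nb w * form_norm b v)" using w v by (rule ab_le)
  also have "\<dots> \<le> C2 * (?E w * ?E v)"
    using pos C by (intro mult_left_mono mult_mono energy_norm_ge)
  finally have 3: "\<bar>ab w v\<bar> \<le> C2 * (?E v * ?E w)" by (simp add: mult.commute)
  have "\<bar>b v w\<bar> \<le> form_norm b v * form_norm b w"
    using form_Cauchy_Schwarz[OF b(1) W b(2,3) v w] by simp
  also have "\<dots> \<le> ?E v * ?E w"
    using pos by (intro mult_mono energy_norm_ge)
  finally have "\<beta> * \<bar>b v w\<bar> \<le> \<beta> * (?E v * ?E w)" using C by (intro mult_left_mono)
  then have 4: "\<bar>\<beta> * b v w\<bar> \<le> \<beta> * (?E v * ?E w)" using C by (simp add: abs_mult)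
  have "\<bar>discrete_form a ab b \<beta> v w\<bar> \<le> \<bar>a v w\<bar> + \<bar>ab v w\<bar> + \<bar>ab w v\<bar> + \<bar>\<beta> * b v w\<bar>"
    unfolding discrete_form_def by linarith
  also have "\<dots> \<le> (C1 + 2 * C2 + \<beta>) * (?E v * ?E w)"
    using 1 2 3 4 by (simp add: algebra_simps)
  finally show ?thesis by (simp add: mult.assoc)
qed

text \<open>In terms of \<open>n = nO v\<close> and \<open>s = form_norm b v\<close>, the form is at
  least \<open>n\<^sup>2 / C1 - 2 * k * n * s + \<beta> * s\<^sup>2\<close> with
  \<open>k = C2 * C3\<close>. Young's inequality spends half of the first term on the mixed one, and
  a large \<open>\<beta>\<close> pays for the rest.\<close>

lemma discrete_form_coercive:
  assumes pos: "0 \<le> b v v" "0 \<le> nO v" "0 \<le> nb v"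
    and a_ge: "(nO v)\<^sup>2 \<le> C1 * a v v"
    and ab_le: "\<bar>ab v v\<bar> \<le> C2 * (nb v * form_norm b v)"
    and nb_le: "nb v \<le> C3 * nO v"
    and C: "0 < C1" "0 < C2" "0 < C3" and \<beta>: "2 * C1 * (C2 * C3)\<^sup>2 + 1 \<le> \<beta>"
  shows "1 / ((2 * C1 + 1) * (1 + C3\<^sup>2)) * (energy_norm nO nb b v)\<^sup>2
    \<le> discrete_form a ab b \<beta> v v"
proof -
  \<comment> \<open>The value of \<open>c\<close> lies below both 1 and \<open>1 / (2 * C1)\<close>,
    so a single constant serves the \<open>n\<close> and the \<open>s\<close> contribution.\<close>
  define n s k c where "n = nO v" and "s = form_norm b v" and "k = C2 * C3"
    and "c = 1 / (2 * C1 + 1)"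
  have s: "b v v = s\<^sup>2" "0 \<le> s" using pos by (simp_all add: s_def form_norm_def)
  have c: "0 < c" "c \<le> 1" "c \<le> 1 / (2 * C1)" using C by (auto simp: c_def field_simps)
  have D: "1 + C3\<^sup>2 \<noteq> 0"
    by (metis add_pos_nonneg less_irrefl zero_le_power2 zero_less_one)
  have E: "(energy_norm nO nb b v)\<^sup>2 = n\<^sup>2 + (nb v)\<^sup>2 + s\<^sup>2"
    by (simp add: energy_norm_def n_def s_def)
  \<comment> \<open>The boundary seminorm is absorbed into \<open>n\<close>, at the price of the
    factor \<open>1 + C3\<^sup>2\<close>.\<close>
  have "(nb v)\<^sup>2 \<le> (C3 * n)\<^sup>2" using nb_le pos by (intro power_mono) (simp_all add: n_def)
  then have "n\<^sup>2 + (nb v)\<^sup>2 + s\<^sup>2 \<le> (1 + C3\<^sup>2) * (n\<^sup>2 + s\<^sup>2)"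
    by (simp add: power_mult_distrib algebra_simps add_increasing2)
  then have "c / (1 + C3\<^sup>2) * (energy_norm nO nb b v)\<^sup>2
      \<le> c / (1 + C3\<^sup>2) * ((1 + C3\<^sup>2) * (n\<^sup>2 + s\<^sup>2))"
    unfolding E using c by (intro mult_left_mono) auto
  also have "\<dots> = c * n\<^sup>2 + c * s\<^sup>2"
    using D by (simp add: distrib_left)
  also have "\<dots> \<le> 1 / (2 * C1) * n\<^sup>2 + 1 * s\<^sup>2"
    using c by (intro add_mono mult_right_mono) auto
  also have "\<dots> \<le> n\<^sup>2 / C1 - 2 * k * n * s + \<beta> * s\<^sup>2"
  proof -
    \<comment> \<open>Young's inequality as a completed square, weighted so that exactly half of
      \<open>n\<^sup>2 / C1\<close> is used.\<close>
    have "0 \<le> (n - 2 * C1 * k * s)\<^sup>2 / (2 * C1)" using C by simp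
    also have "\<dots> = 1 / (2 * C1) * n\<^sup>2 - 2 * k * n * s + 2 * C1 * k\<^sup>2 * s\<^sup>2"
      using C by (simp add: field_simps power2_eq_square)
    finally have "0 \<le> 1 / (2 * C1) * n\<^sup>2 - 2 * k * n * s + 2 * C1 * k\<^sup>2 * s\<^sup>2" .
    \<comment> \<open>The summand 1 in the threshold for \<open>\<beta>\<close> leaves one
      \<open>s\<^sup>2\<close> over after the square has been paid for.\<close>
    moreover have "(2 * C1 * k\<^sup>2 + 1) * s\<^sup>2 \<le> \<beta> * s\<^sup>2"
      using \<beta> by (intro mult_right_mono) (simp_all add: k_def)
    moreover have "n\<^sup>2 / C1 = 1 / (2 * C1) * n\<^sup>2 + 1 / (2 * C1) * n\<^sup>2" by simp
    ultimately show ?thesis by (simp only: distrib_right mult_1)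
  qed
  \<comment> \<open>On the diagonal both boundary terms equal \<open>ab v v\<close>, hence the
    factor 2 in front of \<open>k * n * s\<close>.\<close>
  also have "\<dots> \<le> discrete_form a ab b \<beta> v v"
  proof -
    have "n\<^sup>2 / C1 \<le> a v v" using a_ge C by (simp add: n_def field_simps)
    moreover have "\<bar>ab v v\<bar> \<le> k * n * s"
    proof -
      have "C2 * (nb v * s) \<le> C2 * (C3 * n * s)"
        using nb_le C s by (intro mult_left_mono mult_right_mono) (simp_all add: n_def)
      then show ?thesis using ab_le by (simp add: s_def k_def mult_ac)
    qed
    ultimately show ?thesis unfolding discrete_form_def s(1) by linarith
  qed
  finally show ?thesis by (simp add: c_def)
qed

section \<open>Assembly of the theorem, uniformly over the meshes\<close>

lemma subspace_set_plus:
  "subspace S \<Longrightarrow> subspace T \<Longrightarrow> subspace (S + T)"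
  using subspace_sums[of S T] by (simp add: set_plus_def Bex_def conj_ac)

theorem theorem3p1:
  fixes \<Omega> :: "'d::euclidean_space set"
    and rep :: "'f::real_vector \<Rightarrow> 'd \<Rightarrow> 'c::euclidean_space"
    and V Vt :: "'f set"
    and ip :: "'f \<Rightarrow> 'f \<Rightarrow> real"
    and tr :: "'f \<Rightarrow> 'g::real_vector"
    and g :: 'g
    and a :: "'f \<Rightarrow> 'f \<Rightarrow> real"
    and h0 :: real
    and M :: "real \<Rightarrow> 'm set"  (* meshes of size h, in all positions relative to the domain *)
    and VE :: "real \<Rightarrow> 'm \<Rightarrow> 'f set"
    and ab b :: "real \<Rightarrow> 'm \<Rightarrow> 'f \<Rightarrow> 'f \<Rightarrow> real"  (* the forms a_{boundary} and b *)
    and nO nb :: "real \<Rightarrow> 'm \<Rightarrow> 'f \<Rightarrow> real"  (* interior norm and boundary seminorm *)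
  assumes domain: "open \<Omega>" "connected \<Omega>" "\<Omega> \<noteq> {}"
    and hilbert: "hilbert_space_on V ip"
    and Vt: "subspace Vt" "Vt \<subseteq> V"
    and trace: "linear_on V tr"
    and a_form: "bilinear_form_on V a" "continuous_form_on V (form_norm ip) a"
      "coercive_form_on (boundary_space V tr 0) (form_norm ip) a"
    and h0: "0 < h0"
    and VE: "\<forall>h\<in>{0<..h0}. \<forall>\<tau>\<in>M h. finite_dim_space (VE h \<tau>) \<and> functions_on \<Omega> rep (V + VE h \<tau>)"
    and forms: "\<forall>h\<in>{0<..h0}. \<forall>\<tau>\<in>M h. bilinear_form_on (Vt + VE h \<tau>) a \<and>
      bilinear_form_on (Vt + VE h \<tau>) (ab h \<tau>) \<and> bilinear_form_on (Vt + VE h \<tau>) (b h \<tau>)"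
    and B1_norm: "\<forall>h\<in>{0<..h0}. \<forall>\<tau>\<in>M h. norm_on (Vt + VE h \<tau>) (nO h \<tau>)"
    and B1_cont: "\<exists>C>0. \<forall>h\<in>{0<..h0}. \<forall>\<tau>\<in>M h. \<forall>v\<in>Vt + VE h \<tau>. \<forall>w\<in>Vt + VE h \<tau>.
      a v w \<le> C * (nO h \<tau> v * nO h \<tau> w)"
    and B1_coer: "\<exists>C>0. \<forall>h\<in>{0<..h0}. \<forall>\<tau>\<in>M h. \<forall>v\<in>VE h \<tau>. (nO h \<tau> v)\<^sup>2 \<le> C * a v v"
    and B2_b: "\<forall>h\<in>{0<..h0}. \<forall>\<tau>\<in>M h. \<forall>v\<in>Vt + VE h \<tau>. \<forall>w\<in>Vt + VE h \<tau>.
      b h \<tau> v w = b h \<tau> w v \<and> 0 \<le> b h \<tau> v v"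
    and B2_seminorm: "\<forall>h\<in>{0<..h0}. \<forall>\<tau>\<in>M h. seminorm_on (Vt + VE h \<tau>) (nb h \<tau>)"
    and B2_cont: "\<exists>C>0. \<forall>h\<in>{0<..h0}. \<forall>\<tau>\<in>M h. \<forall>v\<in>Vt + VE h \<tau>. \<forall>w\<in>Vt + VE h \<tau>.
      \<bar>ab h \<tau> v w\<bar> \<le> C * (nb h \<tau> v * form_norm (b h \<tau>) w)"
    and B3: "\<exists>C>0. \<forall>h\<in>{0<..h0}. \<forall>\<tau>\<in>M h. \<forall>v\<in>VE h \<tau>. nb h \<tau> v \<le> C * nO h \<tau> v"
  shows "\<exists>\<beta>0>0. \<forall>\<beta>\<ge>\<beta>0. \<exists>C>0. \<forall>l u.
    \<comment> \<open>the continuous problem, with solution u in the regularity space\<close>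
    linear_on V l \<longrightarrow> continuous_functional_on V (form_norm ip) l \<longrightarrow>
    (\<forall>h\<in>{0<..h0}. \<forall>\<tau>\<in>M h. linear_on (Vt + VE h \<tau>) l) \<longrightarrow>
    u \<in> boundary_space V tr g \<longrightarrow> (\<forall>v\<in>boundary_space V tr 0. a u v = l v) \<longrightarrow> u \<in> Vt \<longrightarrow>
    \<comment> \<open>continuity of the discrete right-hand side\<close>
    (\<exists>C4>0. \<forall>h\<in>{0<..h0}. \<forall>\<tau>\<in>M h. \<forall>v\<in>VE h \<tau>.
       \<bar>discrete_rhs l (ab h \<tau>) (b h \<tau>) \<beta> u v\<bar>
         \<le> C4 * energy_norm (nO h \<tau>) (nb h \<tau>) (b h \<tau>) v) \<longrightarrow>
    \<comment> \<open>consistency\<close>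
    (\<forall>h\<in>{0<..h0}. \<forall>\<tau>\<in>M h. \<forall>v\<in>Vt + VE h \<tau>.
       discrete_form a (ab h \<tau>) (b h \<tau>) \<beta> u v = discrete_rhs l (ab h \<tau>) (b h \<tau>) \<beta> u v) \<longrightarrow>
    (\<forall>h\<in>{0<..h0}. \<forall>\<tau>\<in>M h.
       (\<exists>!uh. uh \<in> VE h \<tau> \<and> (\<forall>v\<in>VE h \<tau>.
          discrete_form a (ab h \<tau>) (b h \<tau>) \<beta> uh v = discrete_rhs l (ab h \<tau>) (b h \<tau>) \<beta> u v)) \<and>
       (\<forall>uh\<in>VE h \<tau>. (\<forall>v\<in>VE h \<tau>.
          discrete_form a (ab h \<tau>) (b h \<tau>) \<beta> uh v = discrete_rhs l (ab h \<tau>) (b h \<tau>) \<beta> u v) \<longrightarrow>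
          (\<forall>v\<in>VE h \<tau>. energy_norm (nO h \<tau>) (nb h \<tau>) (b h \<tau>) (u - uh)
             \<le> C * energy_norm (nO h \<tau>) (nb h \<tau>) (b h \<tau>) (u - v))))"
proof -
  from B1_cont obtain C0 where C0: "0 < C0" and a_le: "\<And>h \<tau> v w. \<lbrakk>h \<in> {0<..h0}; \<tau> \<in> M h;
      v \<in> Vt + VE h \<tau>; w \<in> Vt + VE h \<tau>\<rbrakk> \<Longrightarrow> a v w \<le> C0 * (nO h \<tau> v * nO h \<tau> w)" by blast
  from B1_coer obtain C1 where C1: "0 < C1" and a_ge: "\<And>h \<tau> v. \<lbrakk>h \<in> {0<..h0}; \<tau> \<in> M h;
      v \<in> VE h \<tau>\<rbrakk> \<Longrightarrow> (nO h \<tau> v)\<^sup>2 \<le> C1 * a v v" by blast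
  from B2_cont obtain C2 where C2: "0 < C2" and ab_le: "\<And>h \<tau> v w. \<lbrakk>h \<in> {0<..h0}; \<tau> \<in> M h;
      v \<in> Vt + VE h \<tau>; w \<in> Vt + VE h \<tau>\<rbrakk>
      \<Longrightarrow> \<bar>ab h \<tau> v w\<bar> \<le> C2 * (nb h \<tau> v * form_norm (b h \<tau>) w)" by blast
  from B3 obtain C3 where C3: "0 < C3" and nb_le: "\<And>h \<tau> v. \<lbrakk>h \<in> {0<..h0}; \<tau> \<in> M h;
      v \<in> VE h \<tau>\<rbrakk> \<Longrightarrow> nb h \<tau> v \<le> C3 * nO h \<tau> v" by blast
  \<comment> \<open>Threshold and coercivity constant come from the coercivity lemma. They are built
    from \<open>C1\<close>, \<open>C2\<close> and \<open>C3\<close> alone, hence are the same for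
    all \<open>h\<close> and \<open>\<tau>\<close>.\<close>
  define \<beta>0 c where "\<beta>0 = 2 * C1 * (C2 * C3)\<^sup>2 + 1" and "c = 1 / ((2 * C1 + 1) * (1 + C3\<^sup>2))"
  have \<beta>0: "0 < \<beta>0" using C1 by (simp add: \<beta>0_def add_nonneg_pos)
  have c: "0 < c" using C1 by (simp add: c_def add_pos_nonneg)
  \<comment> \<open>The claim for one mesh, with Cea's constant written out: it involves
    \<open>\<beta>\<close> and the uniform constants, but none of \<open>l\<close>,
    \<open>u\<close>, \<open>h\<close>, \<open>\<tau>\<close>.\<close>
  have main: "(\<exists>!uh. uh \<in> VE h \<tau> \<and> (\<forall>v\<in>VE h \<tau>.
          discrete_form a (ab h \<tau>) (b h \<tau>) \<beta> uh v = discrete_rhs l (ab h \<tau>) (b h \<tau>) \<beta> u v)) \<and>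
       (\<forall>uh\<in>VE h \<tau>. (\<forall>v\<in>VE h \<tau>.
          discrete_form a (ab h \<tau>) (b h \<tau>) \<beta> uh v = discrete_rhs l (ab h \<tau>) (b h \<tau>) \<beta> u v) \<longrightarrow>
          (\<forall>v\<in>VE h \<tau>. energy_norm (nO h \<tau>) (nb h \<tau>) (b h \<tau>) (u - uh)
             \<le> (1 + (C0 + 2 * C2 + \<beta>) / c) * energy_norm (nO h \<tau>) (nb h \<tau>) (b h \<tau>) (u - v)))"
    if \<beta>: "\<beta>0 \<le> \<beta>" and u: "u \<in> Vt" and h: "h \<in> {0<..h0}" "\<tau> \<in> M h"
      and cons: "\<forall>v\<in>Vt + VE h \<tau>.
        discrete_form a (ab h \<tau>) (b h \<tau>) \<beta> u v = discrete_rhs l (ab h \<tau>) (b h \<tau>) \<beta> u v"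
    for \<beta> l u h \<tau>
  proof -
    define W S F N where "W = Vt + VE h \<tau>" and "S = VE h \<tau>"
      and "F = discrete_form a (ab h \<tau>) (b h \<tau>) \<beta>" and "N = energy_norm (nO h \<tau>) (nb h \<tau>) (b h \<tau>)"
    obtain B where B: "finite B" "S = span B"
      using VE h unfolding finite_dim_space_def S_def by blast
    have S: "subspace S" unfolding B(2) by (rule subspace_span)
    have W: "subspace W" using Vt(1) S unfolding W_def S_def by (rule subspace_set_plus)
    have SW: "S \<subseteq> W"
      using set_plus_intro[OF subspace_0[OF Vt(1)]] unfolding W_def S_def by fastforce
    have uW: "u \<in> W"
      using set_plus_intro[OF u subspace_0[OF S]] unfolding W_def S_def by simp
    have fW: "bilinear_form_on W a" "bilinear_form_on W (ab h \<tau>)" "bilinear_form_on W (b h \<tau>)"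
      using forms h unfolding W_def by auto
    have F: "bilinear_form_on W F"
      unfolding F_def using fW by (rule bilinear_form_on_discrete_form)
    have b: "\<And>x y. x \<in> W \<Longrightarrow> y \<in> W \<Longrightarrow> b h \<tau> x y = b h \<tau> y x" "\<And>x. x \<in> W \<Longrightarrow> 0 \<le> b h \<tau> x x"
      using B2_b h unfolding W_def by blast+
    have nO: "seminorm_on W (nO h \<tau>)" "\<And>v. v \<in> W \<Longrightarrow> nO h \<tau> v = 0 \<Longrightarrow> v = 0"
      using B1_norm h unfolding norm_on_def W_def by blast+
    have nb: "seminorm_on W (nb h \<tau>)" using B2_seminorm h unfolding W_def by blast
    have N: "seminorm_on W N"
      unfolding N_def using W nO(1) nb seminorm_on_form_norm[OF fW(3) W b]
      by (intro seminorm_on_energy_norm)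
    have \<beta>p: "0 \<le> \<beta>" using \<beta> \<beta>0 by linarith
    have bdd: "\<bar>F v w\<bar> \<le> (C0 + 2 * C2 + \<beta>) * N v * N w" if "v \<in> W" "w \<in> W" for v w
      unfolding F_def N_def
      using C0 C2 \<beta>p that a_le[OF h] ab_le[OF h]
      by (intro discrete_form_bounded[OF W fW(1,3) b nO(1) nb]) (auto simp: W_def)
    have coer: "c * (N v)\<^sup>2 \<le> F v v" if "v \<in> S" for v
    proof -
      have vW: "v \<in> W" using SW that by blast
      have nn: "0 \<le> nO h \<tau> v" "0 \<le> nb h \<tau> v"
        using nO(1) nb vW unfolding seminorm_on_def by auto
      show ?thesis
        unfolding c_def F_def N_def
        using that vW C1 C2 C3 \<beta> unfolding S_def W_def \<beta>0_def
        by (intro discrete_form_coercive[where ?C2.0 = C2] b(2)[OF vW] nn a_ge[OF h] ab_le[OF h] nb_le[OF h])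
    qed
    \<comment> \<open>Coercivity forces the energy norm to vanish. It dominates \<open>nO\<close>,
      which is a genuine norm, so the form is definite on \<open>S\<close>.\<close>
    have pd: "v = 0" if "v \<in> S" "F v v = 0" for v
    proof -
      have vW: "v \<in> W" using SW that by blast
      have "(N v)\<^sup>2 \<le> 0" using coer[OF that(1)] that(2) c by (simp add: mult_le_0_iff)
      then have "nO h \<tau> v \<le> 0" using energy_norm_ge(1)[of "nO h \<tau>" v "nb h \<tau>" "b h \<tau>"]
        by (simp add: N_def)
      moreover have "0 \<le> nO h \<tau> v" using nO(1) vW unfolding seminorm_on_def by blast
      ultimately show ?thesis using nO(2)[OF vW] by simp
    qed
    \<comment> \<open>Consistency, restricted to discrete test functions, turns the discrete problem
      into the projection problem for \<open>u\<close>.\<close>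
    have rhs: "discrete_rhs l (ab h \<tau>) (b h \<tau>) \<beta> u v = F u v" if "v \<in> S" for v
      using cons that SW unfolding F_def W_def by auto
    have "\<exists>p\<in>S. \<forall>v\<in>S. F p v = F u v"
      unfolding B(2) using B SW W F pd uW by (intro Galerkin_projection_exists) auto
    then obtain p where p: "p \<in> S" "\<And>v. v \<in> S \<Longrightarrow> F p v = F u v" by blast
    have FS: "bilinear_form_on S F" using F SW by (rule bilinear_form_on_subset)
    have "\<exists>!uh. uh \<in> S \<and> (\<forall>v\<in>S. F uh v = F u v)"
      using p Galerkin_projection_unique[OF S FS pd] by (metis (no_types, lifting))
    moreover have "N (u - uh) \<le> (1 + (C0 + 2 * C2 + \<beta>) / c) * N (u - v)"
      if "uh \<in> S" "\<forall>v\<in>S. F uh v = F u v" "v \<in> S" for uh v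
      using that C0 C2 \<beta>p by (intro Cea[OF W S SW F N bdd coer c _ uW]) auto
    ultimately show ?thesis
      unfolding S_def[symmetric] F_def[symmetric] N_def[symmetric] by (simp add: rhs cong: conj_cong)
  qed
  show ?thesis
  proof (rule exI[of _ \<beta>0], intro conjI allI impI)
    fix \<beta> assume \<beta>: "\<beta>0 \<le> \<beta>"
    \<comment> \<open>This constant is fixed after \<open>\<beta>\<close> but before
      \<open>l\<close> and \<open>u\<close>, as the order of quantifiers demands.\<close>
    have "0 < 1 + (C0 + 2 * C2 + \<beta>) / c"
      using C0 C2 \<beta> \<beta>0 c by (intro add_pos_pos divide_pos_pos) auto
    then show "\<exists>C>0. \<forall>l u. linear_on V l \<longrightarrow> continuous_functional_on V (form_norm ip) l \<longrightarrow>
      (\<forall>h\<in>{0<..h0}. \<forall>\<tau>\<in>M h. linear_on (Vt + VE h \<tau>) l) \<longrightarrow>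
      u \<in> boundary_space V tr g \<longrightarrow> (\<forall>v\<in>boundary_space V tr 0. a u v = l v) \<longrightarrow> u \<in> Vt \<longrightarrow>
      (\<exists>C4>0. \<forall>h\<in>{0<..h0}. \<forall>\<tau>\<in>M h. \<forall>v\<in>VE h \<tau>.
         \<bar>discrete_rhs l (ab h \<tau>) (b h \<tau>) \<beta> u v\<bar>
           \<le> C4 * energy_norm (nO h \<tau>) (nb h \<tau>) (b h \<tau>) v) \<longrightarrow>
      (\<forall>h\<in>{0<..h0}. \<forall>\<tau>\<in>M h. \<forall>v\<in>Vt + VE h \<tau>.
         discrete_form a (ab h \<tau>) (b h \<tau>) \<beta> u v = discrete_rhs l (ab h \<tau>) (b h \<tau>) \<beta> u v) \<longrightarrow>
      (\<forall>h\<in>{0<..h0}. \<forall>\<tau>\<in>M h.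
         (\<exists>!uh. uh \<in> VE h \<tau> \<and> (\<forall>v\<in>VE h \<tau>.
            discrete_form a (ab h \<tau>) (b h \<tau>) \<beta> uh v = discrete_rhs l (ab h \<tau>) (b h \<tau>) \<beta> u v)) \<and>
         (\<forall>uh\<in>VE h \<tau>. (\<forall>v\<in>VE h \<tau>.
            discrete_form a (ab h \<tau>) (b h \<tau>) \<beta> uh v = discrete_rhs l (ab h \<tau>) (b h \<tau>) \<beta> u v) \<longrightarrow>
            (\<forall>v\<in>VE h \<tau>. energy_norm (nO h \<tau>) (nb h \<tau>) (b h \<tau>) (u - uh)
               \<le> C * energy_norm (nO h \<tau>) (nb h \<tau>) (b h \<tau>) (u - v))))"
      apply (intro exI[of _ "1 + (C0 + 2 * C2 + \<beta>) / c"] conjI[OF _ allI] allI impI ballI, assumption)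
      by (rule main[OF \<beta>]; blast)
  qed (rule \<beta>0)
qed

end
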